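(* Let $\boldsymbol X_1,\ldots,\boldsymbol X_n\in\mathbb R^d$ and let $$\widetilde{\mathcal Q}:=\{(\psi(\boldsymbol X_1),\ldots,\psi(\boldsymbol X_n)):\ \psi:\mathbb R^d\to\mathbb R\text{ quasiconvex}\}\subseteq\mathbb R^n.$$ A vector $\boldsymbol z\in\mathbb R^n$ belongs to $\widetilde{\mathcal Q}$ if and only if there exist vectors $\boldsymbol\xi_1,\ldots,\boldsymbol\xi_n\in\mathbb R^d$ such that $$\boldsymbol\xi_j^\top(\boldsymbol X_i-\boldsymbol X_j)>0\quad\text{for every } i,j\in\{1,\ldots,n\}\text{ such that } z_i<z_j .$$
   Context: $\psi:\mathbb R^d\to\mathbb R$ is quasiconvex if $\psi(\lambda\boldsymbol x+(1-\lambda)\boldsymbol y)\le\max\{\psi(\boldsymbol x),\psi(\boldsymbol y)\}$ for all $\boldsymbol x,\boldsymbol y\in\mathbb R^d$ and $\lambda\in[0,1]$. *)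

theory Defs
  imports "HOL-Analysis.Analysis"
begin

definition quasiconvex :: "(real ^ 'd \<Rightarrow> real) \<Rightarrow> bool" where
  "quasiconvex \<psi> \<longleftrightarrow>
     (\<forall>x y. \<forall>l\<in>{0..1}. \<psi> (l *\<^sub>R x + (1 - l) *\<^sub>R y) \<le> max (\<psi> x) (\<psi> y))"

definition quasiconvex_vectors :: "('n \<Rightarrow> real ^ 'd) \<Rightarrow> (real ^ 'n) set" where
  "quasiconvex_vectors X = {(\<chi> i. \<psi> (X i)) | \<psi>. quasiconvex \<psi>}"

end

theory Submission
  imports Defs
begin

text \<open>
  If \<open>z i = \<psi> (X i)\<close>, the strict sublevel set of \<open>\<psi>\<close> at height \<open>z j\<close> is convex and misses
  \<open>X j\<close>, so a hyperplane strictly separates \<open>X j\<close> from the convex hull of the points with smaller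
  value. Conversely, \<open>\<psi> x\<close> is taken to be the largest \<open>z k\<close> with \<open>\<xi> k \<bullet> (x - X k) \<le> 0\<close>, or the
  minimum of all \<open>z k\<close> if there is none: a maximum of two-valued step functions, each of which
  has a half-space as its nontrivial sublevel set.
\<close>

lemma quasiconvex_convex_strict_sublevel:
  assumes "quasiconvex \<psi>"
  shows "convex {x. \<psi> x < c}"
proof (rule convexI)
  fix x y and u v :: real
  assume "x \<in> {x. \<psi> x < c}" "y \<in> {x. \<psi> x < c}" and uv: "0 \<le> u" "0 \<le> v" "u + v = 1"
  then have "max (\<psi> x) (\<psi> y) < c"
    by simp
  moreover have "u \<in> {0..1}" and v: "v = 1 - u"
    using uv by auto
  then have "\<psi> (u *\<^sub>R x + v *\<^sub>R y) \<le> max (\<psi> x) (\<psi> y)"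
    using assms unfolding quasiconvex_def by blast
  ultimately show "u *\<^sub>R x + v *\<^sub>R y \<in> {x. \<psi> x < c}"
    using le_less_trans by blast
qed

text \<open>The open half-space where the value is \<open>m\<close> is convex, so a segment meeting
  its complement has an endpoint there. Hence if the value between is \<open>c\<close>, some
  endpoint has value \<open>c\<close> too; if it is \<open>m\<close>, then \<open>m \<le> c\<close>
  suffices.\<close>

lemma quasiconvex_halfspace_step:
  assumes "m \<le> c"
  shows "quasiconvex (\<lambda>x. if a \<bullet> (x - p) \<le> 0 then c else m)"
proof -
  have "a \<bullet> (x - p) \<le> 0 \<or> a \<bullet> (y - p) \<le> 0"
    if l: "l \<in> {0..1}" and le: "a \<bullet> (l *\<^sub>R x + (1 - l) *\<^sub>R y - p) \<le> 0" for x y l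
  proof (rule ccontr)
    assume "\<not> ?thesis"
    then have "x \<in> {x. a \<bullet> x > a \<bullet> p}" "y \<in> {x. a \<bullet> x > a \<bullet> p}"
      by (auto simp: inner_diff_right)
    then have "l *\<^sub>R x + (1 - l) *\<^sub>R y \<in> {x. a \<bullet> x > a \<bullet> p}"
      using l by (intro convexD[OF convex_halfspace_gt]) auto
    then show False
      using le by (simp add: inner_diff_right)
  qed
  then show ?thesis
    using assms unfolding quasiconvex_def
    by (simp add: max_def del: atLeastAtMost_iff) blast
qed

lemma quasiconvex_Max:
  fixes f :: "'i \<Rightarrow> real ^ 'd \<Rightarrow> real"
  assumes "finite I" "I \<noteq> {}" "\<And>k. k \<in> I \<Longrightarrow> quasiconvex (f k)"
  shows "quasiconvex (\<lambda>x. Max ((\<lambda>k. f k x) ` I))"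
  unfolding quasiconvex_def
proof (intro allI ballI)
  fix x y and l :: real
  assume l: "l \<in> {0..1}"
  have "f k (l *\<^sub>R x + (1 - l) *\<^sub>R y) \<le> max (Max ((\<lambda>k. f k x) ` I)) (Max ((\<lambda>k. f k y) ` I))"
    if "k \<in> I" for k
  proof -
    have "f k (l *\<^sub>R x + (1 - l) *\<^sub>R y) \<le> max (f k x) (f k y)"
      using assms(3)[OF that] l unfolding quasiconvex_def by blast
    also have "\<dots> \<le> max (Max ((\<lambda>k. f k x) ` I)) (Max ((\<lambda>k. f k y) ` I))"
      using assms(1) that by (intro max.mono Max_ge) auto
    finally show ?thesis .
  qed
  then show "Max ((\<lambda>k. f k (l *\<^sub>R x + (1 - l) *\<^sub>R y)) ` I)
      \<le> max (Max ((\<lambda>k. f k x) ` I)) (Max ((\<lambda>k. f k y) ` I))"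
    using assms(1,2) by (intro Max.boundedI) auto
qed

lemma quasiconvex_separating_direction:
  fixes \<psi> :: "real ^ 'd::finite \<Rightarrow> real"
  assumes "quasiconvex \<psi>" "finite S" "\<And>x. x \<in> S \<Longrightarrow> \<psi> x < \<psi> p"
  shows "\<exists>a. \<forall>x\<in>S. a \<bullet> (x - p) > 0"
proof -
  have "convex hull S \<subseteq> {x. \<psi> x < \<psi> p}"
    using assms by (intro hull_minimal quasiconvex_convex_strict_sublevel) auto
  then have "p \<notin> convex hull S"
    by auto
  \<comment> \<open>Strict separation needs a closed set, and the strict sublevel set need not be
    closed. The hull of the finite set \<open>S\<close> is compact.\<close>
  moreover have "closed (convex hull S)"
    using assms(2) by (intro compact_imp_closed finite_imp_compact_convex_hull)
  ultimately obtain a b where "a \<bullet> p < b" "\<forall>x\<in>convex hull S. a \<bullet> x > b"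
    using separating_hyperplane_closed_point[OF convex_convex_hull] by metis
  then have "\<forall>x\<in>S. a \<bullet> (x - p) > 0"
    by (simp add: inner_diff_right) (meson hull_inc less_trans)
  then show ?thesis ..
qed

theorem lemma4p3:
  fixes X :: "'n::finite \<Rightarrow> real ^ 'd::finite" and z :: "real ^ 'n"
  shows "z \<in> quasiconvex_vectors X \<longleftrightarrow>
    (\<exists>\<xi> :: 'n \<Rightarrow> real ^ 'd. \<forall>i j. z $ i < z $ j \<longrightarrow> \<xi> j \<bullet> (X i - X j) > 0)"
proof
  assume "z \<in> quasiconvex_vectors X"
  then obtain \<psi> where \<psi>: "quasiconvex \<psi>" and z: "z = (\<chi> i. \<psi> (X i))"
    unfolding quasiconvex_vectors_def by blast
  have "\<exists>a. \<forall>x\<in>X ` {i. z $ i < z $ j}. a \<bullet> (x - X j) > 0" for j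
    using \<psi> by (rule quasiconvex_separating_direction) (auto simp: z)
  then show "\<exists>\<xi>. \<forall>i j. z $ i < z $ j \<longrightarrow> \<xi> j \<bullet> (X i - X j) > 0"
    by (simp add: ball_simps) metis
next
  assume "\<exists>\<xi>. \<forall>i j. z $ i < z $ j \<longrightarrow> \<xi> j \<bullet> (X i - X j) > 0"
  then obtain \<xi> where \<xi>: "\<And>i j. z $ i < z $ j \<Longrightarrow> \<xi> j \<bullet> (X i - X j) > 0"
    by blast
  \<comment> \<open>As the minimum, the default \<open>m\<close> lies below every
    \<open>z $ k\<close>, so the step functions are quasiconvex and the default never exceeds
    \<open>z $ j\<close> at \<open>X j\<close>.\<close>
  define m where "m = Min (range (($) z))"
  have m: "m \<le> z $ k" for k
    unfolding m_def by simp
  define f where "f = (\<lambda>k x. if \<xi> k \<bullet> (x - X k) \<le> 0 then z $ k else m)"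
  have "quasiconvex (\<lambda>x. Max (range (\<lambda>k. f k x)))"
    unfolding f_def by (intro quasiconvex_Max quasiconvex_halfspace_step m) auto
  moreover have "Max (range (\<lambda>k. f k (X j))) = z $ j" for j
  proof (rule Max_eqI)
    \<comment> \<open>The index \<open>j\<close> itself attains the value, since
      \<open>X j - X j = 0\<close> makes the inner product vanish.\<close>
    show "z $ j \<in> range (\<lambda>k. f k (X j))"
      by (rule image_eqI[where x = j]) (auto simp: f_def)
    \<comment> \<open>If \<open>z $ k > z $ j\<close>, the condition on \<open>\<xi> k\<close> gives
      \<open>\<xi> k \<bullet> (X j - X k) > 0\<close>, so \<open>f k (X j)\<close> is only
      \<open>m\<close>.\<close>
    fix y assume "y \<in> range (\<lambda>k. f k (X j))"
    then show "y \<le> z $ j"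
      using \<xi> m by (force simp: f_def not_less[symmetric])
  qed simp
  then have "z = (\<chi> j. Max (range (\<lambda>k. f k (X j))))"
    by (simp add: vec_eq_iff)
  ultimately show "z \<in> quasiconvex_vectors X"
    unfolding quasiconvex_vectors_def
    by (intro CollectI exI[where x = "\<lambda>x. Max (range (\<lambda>k. f k x))"] conjI)
qed

end
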